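(* Let $I_{xx},I_{yy},I_{zz},I_{B_R}$ be positive real numbers (moments of inertia), and put $I_{xx}'=I_{xx}+I_{B_R}$, $I_{zz}'=I_{zz}+I_{B_R}$, $$\alpha=\frac{(I_{xx}-I_{zz})(I_{xx}-I_{yy}+2I_{B_R}+I_{zz})}{2(I_{B_R}+I_{zz})(I_{xx}+I_{B_R})},\qquad \beta=-\frac{I_{xx}-I_{yy}-I_{zz}}{I_{B_R}+I_{zz}},$$ $u_1=2\alpha+\beta-1$, $u_2=1-\beta$, and $\sigma=-(I_{yy}-I_{xx}')(I_{yy}-I_{zz}')$. Consider the linear periodically time-varying system $$\begin{pmatrix}\dot x\\ \dot z\end{pmatrix}=\begin{pmatrix}\alpha\sin(2\tau)&\alpha\cos(2\tau)+(\alpha+\beta)\\ \alpha\cos(2\tau)-(\alpha+\beta)&-\alpha\sin(2\tau)\end{pmatrix}\begin{pmatrix}x\\ z\end{pmatrix}+\begin{pmatrix}\sin\tau\\ \cos\tau\end{pmatrix},\qquad x(0)=z(0)=0.$$ The transition matrix of the homogeneous part is $\Phi(\tau,\tau_0)=P(\tau)e^{(\tau-\tau_0)R}P(\tau_0)^{-1}$ with $$P(\tau)=\begin{pmatrix}\cos\tau&\sin\tau\\ -\sin\tau&\cos\tau\end{pmatrix},\qquad R=\begin{pmatrix}0&u_1\\ u_2&0\end{pmatrix}.$$ The eigenvalues of $R$ are $\pm\sqrt{u_1u_2}$, and $$u_1u_2=-\frac{(I_{yy}-I_{xx}')(I_{yy}-I_{zz}')}{I_{xx}'I_{zz}'}.$$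 Since $I_{xx}'$ and $I_{zz}'$ are positive, the sign of $\sigma$ determines the sign of $u_1u_2$ and thus governs the stability behavior of the system: (i) when $\sigma<0$, the eigenvalues of $R$ are purely imaginary, and the system exhibits bounded, periodic motion (stable); (ii) when $\sigma=0$, the eigenvalues of $R$ vanish, and the system shows linear divergence (the angular velocity $(x,z)$ is proportional to time in amplitude) and is marginally unstable; (iii) when $\sigma>0$, the eigenvalues of $R$ are real, and the system is exponentially unstable. In terms of the inertia parameters, the attitude motion is stable when $I_{xx}'>I_{yy}$ and $I_{zz}'>I_{yy}$, or when $I_{xx}'<I_{yy}$ and $I_{zz}'<I_{yy}$; in all other cases it is unstable.
   Context: The functions $x,z$ are the first-order perturbation components $\hat\omega_x^{(1)},\hat\omega_z^{(1)}$ of the dimensionless angular velocity of a spacecraft platform carrying an unbalanced spinning rotor, with no external torques; a dot denotes $d/d\tau$, where $\tau$ is dimensionless time. The platform is initially at rest, which gives the zero initial condition. The numbers $I_{xx},I_{yy},I_{zz}$ are the diagonal entries of the equivalent spin inertia tensor in the rotor frame, and $I_{B_R}$ is the transverse moment of inertia of the platform. The transition matrix $\Phi(\tau,\tau_0)$ is the solution of the homogeneous matrix equation with $\Phi(\tau_0,\tau_0)$ equal to the identity.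
   Formalization: In (i), (x,z) is bounded and periodic in the rotating frame, but itself periodic only iff sqrt(-u1u2) is rational; in (ii), amplitude equals time only if Iyy=Izz', otherwise it grows like |u1|τ²/2, still marginally unstable. *)

theory Defs
  imports "HOL-Analysis.Analysis"
begin

definition mat2 :: "real \<Rightarrow> real \<Rightarrow> real \<Rightarrow> real \<Rightarrow> real^2^2" where
  "mat2 a b c d = vector [vector [a, b], vector [c, d]]"

definition sys_matrix :: "real \<Rightarrow> real \<Rightarrow> real \<Rightarrow> real^2^2" where
  "sys_matrix \<alpha> \<beta> \<tau> =
     mat2 (\<alpha> * sin (2 * \<tau>)) (\<alpha> * cos (2 * \<tau>) + (\<alpha> + \<beta>))
          (\<alpha> * cos (2 * \<tau>) - (\<alpha> + \<beta>)) (- \<alpha> * sin (2 * \<tau>))"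

definition forcing :: "real \<Rightarrow> real^2" where
  "forcing \<tau> = vector [sin \<tau>, cos \<tau>]"

definition P_mat :: "real \<Rightarrow> real^2^2" where
  "P_mat \<tau> = mat2 (cos \<tau>) (sin \<tau>) (- sin \<tau>) (cos \<tau>)"

definition R_mat :: "real \<Rightarrow> real \<Rightarrow> real^2^2" where
  "R_mat u1 u2 = mat2 0 u1 u2 0"

text \<open>The library function \<^const>\<open>exp\<close> does not apply to the matrix product, since
  the multiplication of type \<^typ>\<open>real^2^2\<close> is componentwise; the exponential
  series is therefore written with \<open>**\<close>.\<close>

definition mat_exp :: "real^'n^'n \<Rightarrow> real^'n^'n" where
  "mat_exp M = (\<Sum>k. (1 / fact k) *\<^sub>R (((\<lambda>N. M ** N) ^^ k) (mat 1)))"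

definition complex_eigenvalues :: "real^'n^'n \<Rightarrow> complex set" where
  "complex_eigenvalues M =
     {\<mu>. \<exists>w::complex^'n. w \<noteq> 0 \<and> (\<chi> i j. complex_of_real (M $ i $ j)) *v w = \<mu> *s w}"

definition is_transition_matrix ::
    "(real \<Rightarrow> real^'n^'n) \<Rightarrow> (real \<Rightarrow> real \<Rightarrow> real^'n^'n) \<Rightarrow> bool" where
  "is_transition_matrix A \<Phi> \<longleftrightarrow>
     (\<forall>\<tau>0. \<Phi> \<tau>0 \<tau>0 = mat 1 \<and>
        (\<forall>\<tau>. ((\<lambda>t. \<Phi> t \<tau>0) has_vector_derivative (A \<tau> ** \<Phi> \<tau> \<tau>0)) (at \<tau>)))"

text \<open>Solutions for \<open>\<tau> \<ge> 0\<close> (one-sided derivative at \<open>0\<close>), with no condition on the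
  initial value.\<close>

definition solves :: "(real \<Rightarrow> real^'n^'n) \<Rightarrow> (real \<Rightarrow> real^'n) \<Rightarrow> (real \<Rightarrow> real^'n) \<Rightarrow> bool" where
  "solves A b w \<longleftrightarrow>
     (\<forall>\<tau>\<ge>0. (w has_vector_derivative (A \<tau> *v w \<tau> + b \<tau>)) (at \<tau> within {0..}))"

text \<open>Stability means boundedness of the forced motion. It cannot be replaced by Lyapunov
  stability: if \<open>u1 = u2 = 0\<close>, the homogeneous system is Lyapunov stable, but the resonant
  forcing still makes the motion grow linearly, and this case counts as unstable.
  For the linear systems considered here, \<open>stable_system\<close> implies Lyapunov stability,
  because differences of solutions solve the homogeneous system.\<close>

definition stable_motion :: "(real \<Rightarrow> 'a::real_normed_vector) \<Rightarrow> bool" where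
  "stable_motion w \<longleftrightarrow> bounded (w ` {0..})"

definition stable_system :: "(real \<Rightarrow> real^'n^'n) \<Rightarrow> (real \<Rightarrow> real^'n) \<Rightarrow> bool" where
  "stable_system A b \<longleftrightarrow> (\<forall>w. solves A b w \<longrightarrow> stable_motion w)"

definition marginally_unstable :: "(real \<Rightarrow> 'a::real_normed_vector) \<Rightarrow> bool" where
  "marginally_unstable w \<longleftrightarrow>
     \<not> stable_motion w \<and> (\<forall>\<epsilon>>0. ((\<lambda>\<tau>. norm (w \<tau>) / exp (\<epsilon> * \<tau>)) \<longlongrightarrow> 0) at_top)"

definition exponentially_unstable :: "(real \<Rightarrow> 'a::real_normed_vector) \<Rightarrow> bool" where
  "exponentially_unstable w \<longleftrightarrow>
     (\<exists>c>0. \<exists>\<mu>>0. \<exists>T. \<forall>\<tau>\<ge>T. c * exp (\<mu> * \<tau>) \<le> norm (w \<tau>))"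

definition periodic_with :: "real \<Rightarrow> (real \<Rightarrow> 'a) \<Rightarrow> bool" where
  "periodic_with T w \<longleftrightarrow> T > 0 \<and> (\<forall>\<tau>\<ge>0. w (\<tau> + T) = w \<tau>)"

end

theory Submission
  imports Defs "HOL-Real_Asymp.Real_Asymp"
begin

text \<open>
  The matrix \<^const>\<open>P_mat\<close> is a rotation, and the coefficient matrix \<open>A\<close> of the system satisfies
  \<open>A P = P' + P R\<close> (\<open>sys_matrix_P_mat\<close>). In the rotating coordinates \<open>w = P\<^sup>-\<^sup>1 v\<close> the system
  therefore has constant coefficients, and since the forcing rotates at the same rate it becomes
  constant too: \<open>w1' = u1 w2\<close>, \<open>w2' = u2 w1 + 1\<close> (\<open>solves_reduced\<close>). The rotation preserves norms,
  so boundedness and growth of \<open>v\<close> and \<open>w\<close> are the same.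

  Linear equations with constant coefficients are governed by the matrix exponential: multiplying a
  solution of \<open>w' = M w\<close> by \<open>exp (- t M)\<close> gives a constant (\<open>linear_ode_unique\<close>). This yields the
  transition matrix and the uniqueness of the motion that starts at rest. That motion is
  \<open>w = (u1 K, S)\<close> with \<open>K' = S\<close>, \<open>S' = 1 + u1 u2 K\<close> and \<open>K 0 = S 0 = 0\<close> (\<open>reduced_solution\<close>), so
  only \<open>u1 u2\<close> decides its type. With \<open>\<omega>\<^sup>2 = \<bar>u1 u2\<bar>\<close>, \<open>S\<close> is \<open>sin (\<omega> t) / \<omega>\<close>, \<open>t\<close> or
  \<open>sinh (\<omega> t) / \<omega>\<close> when \<open>u1 u2\<close> is negative, zero or positive. If \<open>u1 u2 < 0\<close>, every solution is
  bounded because \<open>(u2 w1 + 1)\<^sup>2 - u1 u2 w2\<^sup>2\<close> is conserved and both terms are nonnegative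
  (\<open>stable_system_if_neg\<close>); in the fixed frame the motion is then periodic if and only if its
  frequency \<open>\<omega>\<close> is commensurable with that of the rotation (\<open>periodic_iff_rational_frequency\<close>).

  The inertia parameters give \<open>u1 = (Iyy - Izz') / Ixx'\<close> and \<open>u2 = (Ixx' - Iyy) / Izz'\<close>; thus \<open>u1 u2\<close>
  is \<open>\<sigma>\<close> divided by the positive number \<open>Ixx' Izz'\<close>.
\<close>

section \<open>Derivatives of matrix products\<close>

lemma has_vector_derivative_vecI:
  fixes f :: "real \<Rightarrow> 'a::euclidean_space^'n"
  assumes "\<And>i. ((\<lambda>t. f t $ i) has_vector_derivative f' $ i) (at x within S)"
  shows "(f has_vector_derivative f') (at x within S)"
  unfolding has_vector_derivative_def
proof (subst has_derivative_componentwise_within, rule ballI)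
  fix b :: "'a^'n" assume "b \<in> Basis"
  then obtain i u where b: "b = axis i u"
    by (auto simp: Basis_vec_def)
  show "((\<lambda>t. f t \<bullet> b) has_derivative (\<lambda>h. (h *\<^sub>R f') \<bullet> b)) (at x within S)"
    using has_derivative_inner_left[OF assms[of i, unfolded has_vector_derivative_def], of u]
    by (simp add: b inner_axis)
qed

lemma bounded_bilinear_matrix_mult:
  "bounded_bilinear ((**) :: real^'n^'m \<Rightarrow> real^'p^'n \<Rightarrow> real^'p^'m)"
  unfolding bilinear_conv_bounded_bilinear[symmetric] bilinear_def
  by (auto intro!: linearI simp: vec_eq_iff matrix_matrix_mult_def algebra_simps
        sum.distrib sum_distrib_left)

lemma bounded_bilinear_matrix_vector:
  "bounded_bilinear ((*v) :: real^'n^'m \<Rightarrow> real^'n \<Rightarrow> real^'m)"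
  unfolding bilinear_conv_bounded_bilinear[symmetric] bilinear_def
  by (auto intro!: linearI simp: vec_eq_iff matrix_vector_mult_def algebra_simps
        sum.distrib sum_distrib_left)

lemmas matrix_mult_has_vector_derivative =
  bounded_bilinear.has_vector_derivative[OF bounded_bilinear_matrix_mult]
lemmas matrix_vector_has_vector_derivative =
  bounded_bilinear.has_vector_derivative[OF bounded_bilinear_matrix_vector]

section \<open>The matrix exponential\<close>

text \<open>Powers for the matrix product, since multiplication on this type is componentwise.\<close>

definition mat_pow :: "real^'n^'n \<Rightarrow> nat \<Rightarrow> real^'n^'n" where
  "mat_pow M k = ((\<lambda>N. M ** N) ^^ k) (mat 1)"

lemma mat_pow_0 [simp]: "mat_pow M 0 = mat 1"
  and mat_pow_Suc: "mat_pow M (Suc k) = M ** mat_pow M k"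
  by (simp_all add: mat_pow_def)

lemma mat_pow_commute: "mat_pow M k ** M = M ** mat_pow M k"
  by (induction k) (simp_all add: mat_pow_Suc matrix_mul_assoc[symmetric])

lemma matrix_mult_scaleR:
  fixes A :: "real^'n^'m" and B :: "real^'p^'n"
  shows "(c *\<^sub>R A) ** B = c *\<^sub>R (A ** B)" "A ** (c *\<^sub>R B) = c *\<^sub>R (A ** B)"
  using bounded_bilinear.scaleR_left[OF bounded_bilinear_matrix_mult]
    bounded_bilinear.scaleR_right[OF bounded_bilinear_matrix_mult] by blast+

lemma mat_pow_scaleR: "mat_pow (t *\<^sub>R M) k = t ^ k *\<^sub>R mat_pow M k"
  by (induction k) (simp_all add: mat_pow_Suc matrix_mult_scaleR)

lemma summable_mat_exp:
  fixes M :: "real^'n^'n"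
  shows "summable (\<lambda>k. (1 / fact k) *\<^sub>R mat_pow M k)"
proof -
  obtain K where K: "K \<ge> 0" "\<And>(A::real^'n^'n) (B::real^'n^'n). norm (A ** B) \<le> norm A * norm B * K"
    using bounded_bilinear.nonneg_bounded[OF bounded_bilinear_matrix_mult] by blast
  have bound: "norm (mat_pow M k) \<le> norm (mat 1 :: real^'n^'n) * (K * norm M) ^ k" for k
  proof (induction k)
    case (Suc k)
    have "norm (mat_pow M (Suc k)) \<le> K * norm M * norm (mat_pow M k)"
      using K(2)[of M "mat_pow M k"] by (simp add: mat_pow_Suc mult_ac)
    also have "\<dots> \<le> K * norm M * (norm (mat 1 :: real^'n^'n) * (K * norm M) ^ k)"
      by (intro mult_left_mono Suc) (use K in auto)
    finally show ?case by (simp add: mult_ac)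
  qed simp
  show ?thesis
  proof (rule summable_comparison_test')
    show "summable (\<lambda>k. norm (mat 1 :: real^'n^'n) * ((K * norm M) ^ k /\<^sub>R fact k))"
      by (intro summable_mult summable_exp_generic)
    show "norm ((1 / fact k) *\<^sub>R mat_pow M k)
        \<le> norm (mat 1 :: real^'n^'n) * ((K * norm M) ^ k /\<^sub>R fact k)" for k
      using bound[of k] by (simp add: field_simps)
  qed
qed

lemma mat_exp_pow:
  "mat_exp M = (\<Sum>k. (1 / fact k) *\<^sub>R mat_pow M k)"
  by (simp add: mat_exp_def mat_pow_def)

lemma mat_exp_nth:
  fixes M :: "real^'n^'n"
  shows "(\<lambda>k. (mat_pow M k $ i $ j / fact k) * t ^ k) sums (mat_exp (t *\<^sub>R M) $ i $ j)"
proof -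
  have "(\<lambda>k. (1 / fact k) *\<^sub>R mat_pow (t *\<^sub>R M) k) sums mat_exp (t *\<^sub>R M)"
    unfolding mat_exp_pow by (rule summable_sums[OF summable_mat_exp])
  from bounded_linear.sums[OF bounded_linear_vec_nth bounded_linear.sums[OF bounded_linear_vec_nth this]]
  show ?thesis by (simp add: mat_pow_scaleR mult_ac)
qed

lemma mat_exp_0 [simp]: "mat_exp (0 :: real^'n^'n) = mat 1"
proof -
  have "mat_exp (0 *\<^sub>R (0::real^'n^'n)) $ i $ j = (mat 1 :: real^'n^'n) $ i $ j" for i j
    using sums_unique[OF mat_exp_nth[of "0::real^'n^'n" i j 0], symmetric]
      powser_zero[of "\<lambda>k. mat_pow (0::real^'n^'n) k $ i $ j / fact k"]
    by simp
  then show ?thesis by (simp add: vec_eq_iff)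
qed

text \<open>Each entry of \<open>exp (t M)\<close> is an everywhere convergent real power series in \<open>t\<close>, so the
  theorem on termwise differentiation of power series applies entrywise.\<close>

lemma mat_exp_has_vector_derivative:
  "((\<lambda>t. mat_exp (t *\<^sub>R M)) has_vector_derivative M ** mat_exp (t *\<^sub>R M)) (at t within S)"
proof (intro has_vector_derivative_vecI)
  fix i j
  let ?c = "\<lambda>k. mat_pow M k $ i $ j / fact k"
  have "((\<lambda>t. \<Sum>k. ?c k * t ^ k) has_field_derivative (\<Sum>k. diffs ?c k * t ^ k)) (at t)"
    by (rule termdiffs_strong_converges_everywhere) (rule sums_summable[OF mat_exp_nth])
  also have "(\<lambda>t. \<Sum>k. ?c k * t ^ k) = (\<lambda>t. mat_exp (t *\<^sub>R M) $ i $ j)"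
    by (intro ext sums_unique[symmetric] mat_exp_nth)
  also have "(\<Sum>k. diffs ?c k * t ^ k) = (M ** mat_exp (t *\<^sub>R M)) $ i $ j"
  proof (rule sums_unique[symmetric])
    have "diffs ?c k = mat_pow M (Suc k) $ i $ j / fact k" for k
      by (simp add: diffs_def field_simps del: of_nat_Suc)
    then have "diffs ?c k * t ^ k = (\<Sum>l\<in>UNIV. M $ i $ l * ((mat_pow M k $ l $ j / fact k) * t ^ k))" for k
      by (simp add: mat_pow_Suc matrix_matrix_mult_def sum_divide_distrib sum_distrib_right
          mult_ac) (simp add: sum_distrib_left mult_ac)
    moreover have "(\<lambda>k. \<Sum>l\<in>UNIV. M $ i $ l * ((mat_pow M k $ l $ j / fact k) * t ^ k))
        sums (\<Sum>l\<in>UNIV. M $ i $ l * mat_exp (t *\<^sub>R M) $ l $ j)"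
      by (intro sums_sum sums_mult mat_exp_nth)
    ultimately show "(\<lambda>k. diffs ?c k * t ^ k) sums (M ** mat_exp (t *\<^sub>R M)) $ i $ j"
      by (simp add: matrix_matrix_mult_def)
  qed
  finally show "((\<lambda>t. mat_exp (t *\<^sub>R M) $ i $ j) has_vector_derivative
      (M ** mat_exp (t *\<^sub>R M)) $ i $ j) (at t within S)"
    by (simp add: has_real_derivative_iff_has_vector_derivative has_vector_derivative_at_within)
qed

lemma mat_exp_commute: "mat_exp M ** M = M ** mat_exp M"
proof -
  note b = bounded_bilinear_matrix_mult
  have "mat_exp M ** M = (\<Sum>k. ((1 / fact k) *\<^sub>R mat_pow M k) ** M)"
    unfolding mat_exp_pow
    by (rule bounded_linear.suminf[OF bounded_bilinear.bounded_linear_left[OF b] summable_mat_exp])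
  also have "\<dots> = (\<Sum>k. M ** ((1 / fact k) *\<^sub>R mat_pow M k))"
    by (simp add: matrix_mult_scaleR mat_pow_commute)
  also have "\<dots> = M ** mat_exp M"
    unfolding mat_exp_pow
    by (rule bounded_linear.suminf[OF bounded_bilinear.bounded_linear_right[OF b] summable_mat_exp, symmetric])
  finally show ?thesis .
qed

lemma mat_exp_scaleR_commute: "mat_exp (t *\<^sub>R M) ** M = M ** mat_exp (t *\<^sub>R M)"
proof (cases "t = 0")
  case False
  have "t *\<^sub>R (mat_exp (t *\<^sub>R M) ** M) = t *\<^sub>R (M ** mat_exp (t *\<^sub>R M))"
    using mat_exp_commute[of "t *\<^sub>R M"] by (simp add: matrix_mult_scaleR)
  with False show ?thesis by simp
qed simp

lemma mat_exp_shift_has_vector_derivative: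
  "((\<lambda>t. mat_exp ((t - s) *\<^sub>R M)) has_vector_derivative M ** mat_exp ((t - s) *\<^sub>R M))
    (at t within S)"
proof -
  have "((\<lambda>t. t - s) has_vector_derivative 1) (at t)"
    by (auto intro!: derivative_eq_intros simp: has_real_derivative_iff_has_vector_derivative[symmetric])
  from vector_diff_chain_at[OF this mat_exp_has_vector_derivative]
  have "((\<lambda>t. mat_exp ((t - s) *\<^sub>R M)) has_vector_derivative M ** mat_exp ((t - s) *\<^sub>R M)) (at t)"
    by (simp add: o_def)
  then show ?thesis by (rule has_vector_derivative_at_within)
qed

lemma mat_exp_reverse_has_vector_derivative:
  "((\<lambda>t. mat_exp ((s - t) *\<^sub>R M)) has_vector_derivative - (mat_exp ((s - t) *\<^sub>R M) ** M))
    (at t within S)"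
proof -
  have "((\<lambda>t. s - t) has_vector_derivative - 1) (at t)"
    by (auto intro!: derivative_eq_intros simp: has_real_derivative_iff_has_vector_derivative[symmetric])
  from vector_diff_chain_at[OF this mat_exp_has_vector_derivative]
  have "((\<lambda>t. mat_exp ((s - t) *\<^sub>R M)) has_vector_derivative
      - (mat_exp ((s - t) *\<^sub>R M) ** M)) (at t)"
    by (simp add: o_def mat_exp_scaleR_commute)
  then show ?thesis by (rule has_vector_derivative_at_within)
qed

text \<open>The product has derivative \<open>0\<close>, because \<open>M\<close> commutes with its exponential.\<close>

lemma mat_exp_inverse: "mat_exp (t *\<^sub>R M) ** mat_exp ((- t) *\<^sub>R M) = mat 1"
proof -
  let ?f = "\<lambda>t. mat_exp ((t - 0) *\<^sub>R M) ** mat_exp ((0 - t) *\<^sub>R M)"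
  have "(?f has_vector_derivative 0) (at r within UNIV)" for r
  proof -
    have "(?f has_vector_derivative mat_exp ((r - 0) *\<^sub>R M) ** - (mat_exp ((0 - r) *\<^sub>R M) ** M)
        + (M ** mat_exp ((r - 0) *\<^sub>R M)) ** mat_exp ((0 - r) *\<^sub>R M)) (at r within UNIV)"
      by (rule matrix_mult_has_vector_derivative mat_exp_shift_has_vector_derivative
          mat_exp_reverse_has_vector_derivative)+
    moreover have "mat_exp ((r - 0) *\<^sub>R M) ** (mat_exp ((0 - r) *\<^sub>R M) ** M)
        = (M ** mat_exp ((r - 0) *\<^sub>R M)) ** mat_exp ((0 - r) *\<^sub>R M)"
      by (metis mat_exp_scaleR_commute matrix_mul_assoc)
    ultimately show ?thesis
      by (simp add: bounded_bilinear.minus_right[OF bounded_bilinear_matrix_mult])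
  qed
  then obtain c where "\<And>t. ?f t = c"
    using has_vector_derivative_zero_constant[of UNIV ?f] by auto
  from this[of t] this[of 0] show ?thesis by simp
qed

lemma mat_exp_nilpotent:
  assumes "M ** M = 0"
  shows "mat_exp (t *\<^sub>R M) = mat 1 + t *\<^sub>R M"
proof -
  have z: "mat_pow (t *\<^sub>R M) k = 0" if "k \<notin> {0, 1}" for k
  proof -
    obtain m where "k = Suc (Suc m)"
      using \<open>k \<notin> {0, 1}\<close> by (metis One_nat_def insertCI not0_implies_Suc)
    then show ?thesis
      using assms by (simp add: mat_pow_scaleR mat_pow_Suc matrix_mul_assoc matrix_mult_scaleR
          bounded_bilinear.zero_left[OF bounded_bilinear_matrix_mult])
  qed
  have "mat_exp (t *\<^sub>R M) = (\<Sum>k\<in>{0, 1}. (1 / fact k) *\<^sub>R mat_pow (t *\<^sub>R M) k)"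
    unfolding mat_exp_pow by (rule suminf_finite) (simp_all add: z)
  then show ?thesis by (simp add: mat_pow_Suc)
qed

text \<open>The integrating factor \<open>exp ((s - t) M)\<close> turns every solution of \<open>w' = M w\<close> into a constant.
  Allowing any convex \<open>S\<close> covers both the full line, needed for transition matrices, and the
  half-line with its one-sided derivative at \<open>0\<close>.\<close>

lemma linear_ode_unique:
  fixes w :: "real \<Rightarrow> real^'n"
  assumes S: "convex S" "s \<in> S" "t \<in> S"
    and w: "\<And>t. t \<in> S \<Longrightarrow> (w has_vector_derivative M *v w t) (at t within S)"
  shows "w t = mat_exp ((t - s) *\<^sub>R M) *v w s"
proof -
  let ?g = "\<lambda>t. mat_exp ((s - t) *\<^sub>R M) *v w t"
  have "(?g has_vector_derivative 0) (at t within S)" if "t \<in> S" for t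
  proof -
    have "(?g has_vector_derivative mat_exp ((s - t) *\<^sub>R M) *v (M *v w t)
        + (- (mat_exp ((s - t) *\<^sub>R M) ** M)) *v w t) (at t within S)"
      by (rule matrix_vector_has_vector_derivative w that mat_exp_reverse_has_vector_derivative)+
    then show ?thesis
      by (simp add: matrix_vector_mul_assoc bounded_bilinear.minus_left[OF bounded_bilinear_matrix_vector])
  qed
  then obtain c where c: "\<And>t. t \<in> S \<Longrightarrow> ?g t = c"
    using has_vector_derivative_zero_constant[of S ?g] S(1) by blast
  have "w s = ?g t"
    using c[OF S(2)] c[OF S(3)] by simp
  then have "mat_exp ((t - s) *\<^sub>R M) *v w s
      = (mat_exp ((t - s) *\<^sub>R M) ** mat_exp ((- (t - s)) *\<^sub>R M)) *v w t"
    by (simp add: matrix_vector_mul_assoc)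
  then show ?thesis
    by (simp only: mat_exp_inverse matrix_vector_mul_lid)
qed

section \<open>The rotating frame\<close>

lemmas mat_2_simps = vec_eq_iff forall_2 matrix_matrix_mult_def matrix_vector_mult_def sum_2
  mat2_def mat_def

lemma P_mat_add: "P_mat s ** P_mat t = P_mat (s + t)"
  by (simp add: P_mat_def mat_2_simps sin_add cos_add)

lemma P_mat_0 [simp]: "P_mat 0 = mat 1"
  by (simp add: P_mat_def mat_2_simps)

lemma P_mat_inverse: "matrix_inv (P_mat t) = P_mat (- t)"
proof -
  have "matrix_inv (P_mat t) ** P_mat t = mat 1"
    unfolding matrix_inv_def by (rule someI2[of _ "P_mat (- t)"]) (simp_all add: P_mat_add)
  then have "matrix_inv (P_mat t) ** (P_mat t ** P_mat (- t)) = P_mat (- t)"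
    by (simp add: matrix_mul_assoc)
  then show ?thesis by (simp add: P_mat_add)
qed

lemma P_mat_minus_cancel [simp]:
  "P_mat t *v (P_mat (- t) *v y) = y" "P_mat (- t) *v (P_mat t *v y) = y"
  by (simp_all add: matrix_vector_mul_assoc P_mat_add)

lemma norm_vec2: "norm (y :: real^2) = sqrt ((y $ 1)\<^sup>2 + (y $ 2)\<^sup>2)"
  by (simp add: norm_vec_def L2_set_def sum_2)

lemma norm_P_mat [simp]: "norm (P_mat t *v y) = norm y"
proof -
  have "(cos t * y $ 1 + sin t * y $ 2)\<^sup>2 + (- sin t * y $ 1 + cos t * y $ 2)\<^sup>2
      = ((sin t)\<^sup>2 + (cos t)\<^sup>2) * ((y $ 1)\<^sup>2 + (y $ 2)\<^sup>2)"
    by (simp only: power2_eq_square) algebra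
  then show ?thesis
    by (simp add: norm_vec2 P_mat_def mat2_def matrix_vector_mult_def sum_2)
qed

text \<open>In the scalar product of \<open>P_mat T *v y = y\<close> with \<open>y\<close> the sine terms cancel.\<close>

lemma P_mat_fixed_vector:
  assumes "P_mat T *v y = y" "y \<noteq> 0"
  shows "cos T = 1"
proof -
  have "cos T * y $ 1 + sin T * y $ 2 = y $ 1" "- sin T * y $ 1 + cos T * y $ 2 = y $ 2"
    using assms(1) by (simp_all add: P_mat_def mat_2_simps)
  then have "(cos T * y $ 1 + sin T * y $ 2) * y $ 1 + (- sin T * y $ 1 + cos T * y $ 2) * y $ 2
      = y $ 1 * y $ 1 + y $ 2 * y $ 2"
    by (simp only:)
  then have "(cos T - 1) * (y $ 1 * y $ 1 + y $ 2 * y $ 2) = 0"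
    by (simp add: algebra_simps)
  moreover have "y $ 1 * y $ 1 + y $ 2 * y $ 2 \<noteq> 0"
    using assms(2) by (auto simp: sum_squares_eq_zero_iff vec_eq_iff forall_2)
  ultimately have "cos T - 1 = 0" by (metis mult_eq_0_iff)
  then show ?thesis by simp
qed

lemma P_mat_has_vector_derivative:
  "(P_mat has_vector_derivative mat2 0 1 (- 1) 0 ** P_mat t) (at t within S)"
proof (intro has_vector_derivative_vecI)
  fix i j :: 2
  show "((\<lambda>t. P_mat t $ i $ j) has_vector_derivative (mat2 0 1 (- 1) 0 ** P_mat t) $ i $ j)
      (at t within S)"
    using exhaust_2[of i] exhaust_2[of j]
    by (auto simp: P_mat_def mat2_def matrix_matrix_mult_def sum_2
        has_real_derivative_iff_has_vector_derivative[symmetric] intro!: derivative_eq_intros)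
qed

text \<open>The Floquet factorization of the coefficient matrix. Here \<open>mat2 0 1 (- 1) 0\<close> generates the
  rotation: \<open>P' = mat2 0 1 (- 1) 0 ** P\<close>. The first form serves to check a candidate solution
  \<open>P w\<close>, the second to pass from a solution \<open>v\<close> to \<open>P\<^sup>-\<^sup>1 v\<close>.\<close>

lemma sys_matrix_P_mat:
  assumes u: "u1 = 2 * \<alpha> + \<beta> - 1" "u2 = 1 - \<beta>"
  shows "sys_matrix \<alpha> \<beta> t ** P_mat t = mat2 0 1 (- 1) 0 ** P_mat t + P_mat t ** R_mat u1 u2"
    and "P_mat (- t) ** sys_matrix \<alpha> \<beta> t = (mat2 0 1 (- 1) 0 + R_mat u1 u2) ** P_mat (- t)"
proof -
  have sc: "sin t * sin t + cos t * cos t = 1"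
    using sin_cos_squared_add[of t] by (simp add: power2_eq_square)
  show "sys_matrix \<alpha> \<beta> t ** P_mat t = mat2 0 1 (- 1) 0 ** P_mat t + P_mat t ** R_mat u1 u2"
    unfolding u sys_matrix_def P_mat_def R_mat_def
    by (simp add: mat_2_simps sin_double cos_double power2_eq_square; intro conjI; insert sc; algebra)
  show "P_mat (- t) ** sys_matrix \<alpha> \<beta> t = (mat2 0 1 (- 1) 0 + R_mat u1 u2) ** P_mat (- t)"
    unfolding u sys_matrix_def P_mat_def R_mat_def
    by (simp add: mat_2_simps sin_double cos_double power2_eq_square; intro conjI; insert sc; algebra)
qed

lemma P_mat_forcing: "P_mat (- t) *v forcing t = vector [0, 1]"
  using sin_cos_squared_add[of t]
  by (simp add: P_mat_def forcing_def mat_2_simps power2_eq_square)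

lemma P_mat_minus_has_vector_derivative:
  "((\<lambda>t. P_mat (- t)) has_vector_derivative - (mat2 0 1 (- 1) 0 ** P_mat (- t))) (at t within S)"
proof (intro has_vector_derivative_vecI)
  fix i j :: 2
  show "((\<lambda>t. P_mat (- t) $ i $ j) has_vector_derivative (- (mat2 0 1 (- 1) 0 ** P_mat (- t))) $ i $ j)
      (at t within S)"
    using exhaust_2[of i] exhaust_2[of j]
    by (auto simp: P_mat_def mat2_def matrix_matrix_mult_def sum_2
        has_real_derivative_iff_has_vector_derivative[symmetric] intro!: derivative_eq_intros)
qed

text \<open>By the product rule the rotation of the frame contributes \<open>- mat2 0 1 (- 1) 0 ** P_mat (- t)\<close>.
  It cancels the corresponding term of \<open>sys_matrix_P_mat(2)\<close>, so that only the constant matrix \<open>R\<close>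
  remains.\<close>

lemma rotating_frame:
  assumes u: "u1 = 2 * \<alpha> + \<beta> - 1" "u2 = 1 - \<beta>"
    and v: "(v has_vector_derivative sys_matrix \<alpha> \<beta> t *v v t + f) (at t within S)"
  shows "((\<lambda>t. P_mat (- t) *v v t) has_vector_derivative
    R_mat u1 u2 *v (P_mat (- t) *v v t) + P_mat (- t) *v f) (at t within S)"
proof -
  have "((\<lambda>t. P_mat (- t) *v v t) has_vector_derivative
      P_mat (- t) *v (sys_matrix \<alpha> \<beta> t *v v t + f) + (- (mat2 0 1 (- 1) 0 ** P_mat (- t))) *v v t)
      (at t within S)"
    by (rule matrix_vector_has_vector_derivative P_mat_minus_has_vector_derivative v)+
  moreover have "P_mat (- t) *v (sys_matrix \<alpha> \<beta> t *v v t)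
      = mat2 0 1 (- 1) 0 *v (P_mat (- t) *v v t) + R_mat u1 u2 *v (P_mat (- t) *v v t)"
    unfolding matrix_vector_mul_assoc[of "P_mat (- t)"] sys_matrix_P_mat(2)[OF u]
    by (simp only: matrix_vector_mult_add_rdistrib matrix_vector_mul_assoc[symmetric])
  ultimately show ?thesis
    by (simp add: matrix_vector_right_distrib matrix_vector_mul_assoc[symmetric]
        bounded_bilinear.minus_left[OF bounded_bilinear_matrix_vector])
qed

section \<open>The transition matrix and the eigenvalues of R\<close>

text \<open>For uniqueness, \<open>P\<^sup>-\<^sup>1 \<Phi> y\<close> solves \<open>w' = R w\<close> on the whole line for each vector \<open>y\<close>, and these
  vectors determine \<open>\<Phi>\<close>.\<close>

lemma transition_matrix_iff:
  assumes u: "u1 = 2 * \<alpha> + \<beta> - 1" "u2 = 1 - \<beta>"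
  shows "is_transition_matrix (sys_matrix \<alpha> \<beta>) \<Phi> \<longleftrightarrow>
    \<Phi> = (\<lambda>t s. P_mat t ** mat_exp ((t - s) *\<^sub>R R_mat u1 u2) ** matrix_inv (P_mat s))"
    (is "_ \<longleftrightarrow> \<Phi> = ?\<Psi>")
proof
  assume \<Phi>: "is_transition_matrix (sys_matrix \<alpha> \<beta>) \<Phi>"
  have "\<Phi> t s *v y = ?\<Psi> t s *v y" for t s y
  proof -
    let ?w = "\<lambda>t. P_mat (- t) *v (\<Phi> t s *v y)"
    have d\<Phi>: "((\<lambda>t. \<Phi> t s) has_vector_derivative sys_matrix \<alpha> \<beta> r ** \<Phi> r s) (at r)" for r
      using \<Phi> by (simp add: is_transition_matrix_def)
    have "((\<lambda>t. \<Phi> t s *v y) has_vector_derivative sys_matrix \<alpha> \<beta> r *v (\<Phi> r s *v y) + 0) (at r)" for r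
      using matrix_vector_has_vector_derivative[OF d\<Phi> has_vector_derivative_const[of y]]
      by (simp add: matrix_vector_mul_assoc)
    from rotating_frame[OF u this]
    have "(?w has_vector_derivative R_mat u1 u2 *v ?w r) (at r within UNIV)" for r
      by simp
    from linear_ode_unique[OF _ _ _ this, of s t]
    have "?w t = mat_exp ((t - s) *\<^sub>R R_mat u1 u2) *v ?w s" by simp
    then have "P_mat t *v ?w t = P_mat t *v (mat_exp ((t - s) *\<^sub>R R_mat u1 u2) *v ?w s)"
      by simp
    then show ?thesis
      using \<Phi> by (simp add: is_transition_matrix_def P_mat_inverse matrix_vector_mul_assoc[symmetric])
  qed
  then show "\<Phi> = ?\<Psi>"
    by (intro ext) (simp add: matrix_eq)
next
  assume \<Phi>: "\<Phi> = ?\<Psi>"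
  show "is_transition_matrix (sys_matrix \<alpha> \<beta>) \<Phi>"
    unfolding is_transition_matrix_def
  proof (intro allI conjI)
    fix s t
    show "\<Phi> s s = mat 1"
      by (simp add: \<Phi> P_mat_inverse P_mat_add)
    let ?R = "R_mat u1 u2" and ?J = "mat2 0 1 (- 1) 0"
    have "((\<lambda>t. P_mat t ** mat_exp ((t - s) *\<^sub>R ?R)) has_vector_derivative
        P_mat t ** (?R ** mat_exp ((t - s) *\<^sub>R ?R)) + (?J ** P_mat t) ** mat_exp ((t - s) *\<^sub>R ?R)) (at t)"
      by (rule matrix_mult_has_vector_derivative P_mat_has_vector_derivative
          mat_exp_shift_has_vector_derivative)+
    also have "P_mat t ** (?R ** mat_exp ((t - s) *\<^sub>R ?R)) + (?J ** P_mat t) ** mat_exp ((t - s) *\<^sub>R ?R)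
        = sys_matrix \<alpha> \<beta> t ** P_mat t ** mat_exp ((t - s) *\<^sub>R ?R)"
      by (simp add: sys_matrix_P_mat(1)[OF u] matrix_mul_assoc
          bounded_bilinear.add_left[OF bounded_bilinear_matrix_mult])
    finally show "((\<lambda>t. \<Phi> t s) has_vector_derivative sys_matrix \<alpha> \<beta> t ** \<Phi> t s) (at t)"
      using matrix_mult_has_vector_derivative[OF _ has_vector_derivative_const[of "matrix_inv (P_mat s)"]]
      by (fastforce simp: \<Phi> matrix_mul_assoc)
  qed
qed

text \<open>The second component of \<open>R w = \<mu> w\<close> fed into the first gives \<open>\<mu>\<^sup>2 w = u1 u2 w\<close>. Conversely
  \<open>(u1, \<mu>)\<close> is an eigenvector unless \<open>u1 = 0\<close>, when \<open>\<mu> = 0\<close> and \<open>(0, 1)\<close> is one.\<close>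

lemma complex_eigenvalues_R_mat:
  "complex_eigenvalues (R_mat u1 u2) =
    {csqrt (complex_of_real (u1 * u2)), - csqrt (complex_of_real (u1 * u2))}"
proof -
  let ?c = "complex_of_real"
  have sys: "(\<chi> i j. ?c (R_mat u1 u2 $ i $ j)) *v w = \<mu> *s w \<longleftrightarrow>
      ?c u1 * w $ 2 = \<mu> * w $ 1 \<and> ?c u2 * w $ 1 = \<mu> * w $ 2" for \<mu> w
    by (simp add: vec_eq_iff forall_2 matrix_vector_mult_def sum_2 R_mat_def mat2_def)
  have "(\<exists>w :: complex^2. w \<noteq> 0 \<and> ?c u1 * w $ 2 = \<mu> * w $ 1 \<and> ?c u2 * w $ 1 = \<mu> * w $ 2)
      \<longleftrightarrow> \<mu>\<^sup>2 = ?c (u1 * u2)" for \<mu>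
  proof
    assume "\<exists>w :: complex^2. w \<noteq> 0 \<and> ?c u1 * w $ 2 = \<mu> * w $ 1 \<and> ?c u2 * w $ 1 = \<mu> * w $ 2"
    then obtain w :: "complex^2" where "w \<noteq> 0 \<and> ?c u1 * w $ 2 = \<mu> * w $ 1 \<and> ?c u2 * w $ 1 = \<mu> * w $ 2" ..
    then have w: "w \<noteq> 0" and e: "?c u1 * w $ 2 = \<mu> * w $ 1" "?c u2 * w $ 1 = \<mu> * w $ 2"
      by simp_all
    have "\<mu>\<^sup>2 * w $ 1 = ?c u1 * (\<mu> * w $ 2)"
      by (simp only: power2_eq_square mult.assoc e(1)[symmetric] mult.left_commute[of \<mu>])
    also have "\<dots> = ?c (u1 * u2) * w $ 1"
      by (simp only: e(2)[symmetric] of_real_mult mult.assoc)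
    finally have "\<mu>\<^sup>2 * w $ 1 = ?c (u1 * u2) * w $ 1" .
    moreover have "\<mu>\<^sup>2 * w $ 2 = ?c u2 * (\<mu> * w $ 1)"
      by (simp only: power2_eq_square mult.assoc e(2)[symmetric] mult.left_commute[of \<mu>])
    then have "\<mu>\<^sup>2 * w $ 2 = ?c (u1 * u2) * w $ 2"
      by (simp only: e(1)[symmetric] of_real_mult mult_ac)
    ultimately show "\<mu>\<^sup>2 = ?c (u1 * u2)"
      using w by (auto simp: vec_eq_iff forall_2)
  next
    assume \<mu>: "\<mu>\<^sup>2 = ?c (u1 * u2)"
    show "\<exists>w :: complex^2. w \<noteq> 0 \<and> ?c u1 * w $ 2 = \<mu> * w $ 1 \<and> ?c u2 * w $ 1 = \<mu> * w $ 2"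
    proof (cases "u1 = 0")
      case True
      then show ?thesis
        using \<mu> by (intro exI[of _ "vector [0, 1]"]) (simp add: vec_eq_iff forall_2)
    next
      case False
      then show ?thesis
        using \<mu> by (intro exI[of _ "vector [?c u1, \<mu>]"])
          (auto simp: vec_eq_iff forall_2 power2_eq_square mult_ac)
    qed
  qed
  then have "complex_eigenvalues (R_mat u1 u2) = {\<mu>. \<mu>\<^sup>2 = ?c (u1 * u2)}"
    by (simp add: complex_eigenvalues_def sys)
  also have "\<dots> = {\<mu>. \<mu>\<^sup>2 = (csqrt (?c (u1 * u2)))\<^sup>2}"
    by (simp only: power2_csqrt)
  also have "\<dots> = {csqrt (?c (u1 * u2)), - csqrt (?c (u1 * u2))}"
    by (simp only: power2_eq_iff) auto
  finally show ?thesis .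
qed

lemma R_mat_square: "R_mat u1 u2 ** R_mat u1 u2 = (u1 * u2) *\<^sub>R mat 1"
  by (simp add: R_mat_def mat_2_simps)

section \<open>The reduced equation and the motion from rest\<close>

lemma solves_reduced:
  assumes u: "u1 = 2 * \<alpha> + \<beta> - 1" "u2 = 1 - \<beta>"
    and v: "solves (sys_matrix \<alpha> \<beta>) forcing v" and t: "t \<ge> 0"
  shows "((\<lambda>t. P_mat (- t) *v v t) has_vector_derivative
    R_mat u1 u2 *v (P_mat (- t) *v v t) + vector [0, 1]) (at t within {0..})"
  using rotating_frame[OF u, of v t "forcing t"] v t by (simp add: solves_def P_mat_forcing)

text \<open>One formula for all three stability types: they differ only in the solution of
  \<open>K'' = 1 + u1 u2 K\<close>. The difference between \<open>P\<^sup>-\<^sup>1 v\<close> and the formula solves the homogeneous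
  reduced equation and starts at \<open>0\<close>.\<close>

lemma reduced_solution:
  assumes u: "u1 = 2 * \<alpha> + \<beta> - 1" "u2 = 1 - \<beta>"
    and v: "solves (sys_matrix \<alpha> \<beta>) forcing v" "v 0 = 0"
    and K: "\<And>t. (K has_real_derivative S t) (at t)" "K 0 = 0"
    and S: "\<And>t. (S has_real_derivative 1 + u1 * u2 * K t) (at t)" "S 0 = 0"
    and t: "t \<ge> 0"
  shows "P_mat (- t) *v v t = vector [u1 * K t, S t]"
proof -
  let ?h = "\<lambda>t. vector [u1 * K t, S t] :: real^2"
  let ?d = "\<lambda>t. P_mat (- t) *v v t - ?h t"
  have h: "(?h has_vector_derivative R_mat u1 u2 *v ?h r + vector [0, 1]) (at r within {0..})" for r
  proof (rule has_vector_derivative_vecI)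
    fix i :: 2
    show "((\<lambda>t. ?h t $ i) has_vector_derivative (R_mat u1 u2 *v ?h r + vector [0, 1]) $ i)
        (at r within {0..})"
      using exhaust_2[of i]
        DERIV_cmult[OF K(1)[of r, THEN has_field_derivative_at_within], of u1 "{0..}"]
        S(1)[of r, THEN has_field_derivative_at_within, of "{0..}"]
      by (auto simp: R_mat_def mat2_def matrix_vector_mult_def sum_2 algebra_simps
          has_real_derivative_iff_has_vector_derivative)
  qed
  have "(?d has_vector_derivative R_mat u1 u2 *v ?d r) (at r within {0..})" if "r \<in> {0..}" for r
    using has_vector_derivative_diff[OF solves_reduced[OF u v(1)] h] that
    by (simp add: matrix_vector_mult_diff_distrib)
  from linear_ode_unique[of "{0..}" 0 t ?d, OF _ _ _ this] t
  have "?d t = mat_exp (t *\<^sub>R R_mat u1 u2) *v ?d 0"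
    by simp
  moreover have "?d 0 = 0"
    by (simp add: v(2) K(2) S(2) vec_eq_iff forall_2)
  ultimately show ?thesis by simp
qed

lemma reduced_solution_oscillating:
  assumes u: "u1 = 2 * \<alpha> + \<beta> - 1" "u2 = 1 - \<beta>"
    and v: "solves (sys_matrix \<alpha> \<beta>) forcing v" "v 0 = 0"
    and \<omega>: "\<omega> \<noteq> 0" "u1 * u2 = - \<omega>\<^sup>2" and t: "t \<ge> 0"
  shows "P_mat (- t) *v v t = vector [u1 * ((1 - cos (\<omega> * t)) / \<omega>\<^sup>2), sin (\<omega> * t) / \<omega>]"
  by (rule reduced_solution[OF u v, where K = "\<lambda>t. (1 - cos (\<omega> * t)) / \<omega>\<^sup>2"])
    (auto intro!: derivative_eq_intros simp: \<omega> t power2_eq_square field_simps)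

lemma reduced_solution_degenerate:
  assumes u: "u1 = 2 * \<alpha> + \<beta> - 1" "u2 = 1 - \<beta>"
    and v: "solves (sys_matrix \<alpha> \<beta>) forcing v" "v 0 = 0"
    and 0: "u1 * u2 = 0" and t: "t \<ge> 0"
  shows "P_mat (- t) *v v t = vector [u1 * (t\<^sup>2 / 2), t]"
  by (rule reduced_solution[OF u v, where K = "\<lambda>t. t\<^sup>2 / 2"])
    (use 0 in \<open>auto intro!: derivative_eq_intros simp: t\<close>)

lemma reduced_solution_hyperbolic:
  assumes u: "u1 = 2 * \<alpha> + \<beta> - 1" "u2 = 1 - \<beta>"
    and v: "solves (sys_matrix \<alpha> \<beta>) forcing v" "v 0 = 0"
    and \<omega>: "\<omega> \<noteq> 0" "u1 * u2 = \<omega>\<^sup>2" and t: "t \<ge> 0"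
  shows "P_mat (- t) *v v t = vector [u1 * ((cosh (\<omega> * t) - 1) / \<omega>\<^sup>2), sinh (\<omega> * t) / \<omega>]"
  by (rule reduced_solution[OF u v, where K = "\<lambda>t. (cosh (\<omega> * t) - 1) / \<omega>\<^sup>2"])
    (auto intro!: derivative_eq_intros simp: \<omega> t power2_eq_square field_simps)

lemma norm_rotated:
  assumes "P_mat (- t) *v y = vector [a, b]"
  shows "norm y = sqrt (a\<^sup>2 + b\<^sup>2)"
  using norm_P_mat[of "- t" y] by (simp add: assms norm_vec2)

section \<open>Stability types\<close>

text \<open>The quantity \<open>E = (u2 w1 + 1)\<^sup>2 - u1 u2 w2\<^sup>2\<close> is conserved by the reduced equation. For
  \<open>u1 u2 < 0\<close> both terms are nonnegative, so each is bounded by the constant value of \<open>E\<close>, whatever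
  the initial value.\<close>

lemma stable_system_if_neg:
  assumes u: "u1 = 2 * \<alpha> + \<beta> - 1" "u2 = 1 - \<beta>" and neg: "u1 * u2 < 0"
  shows "stable_system (sys_matrix \<alpha> \<beta>) forcing"
  unfolding stable_system_def stable_motion_def
proof (intro allI impI)
  fix v assume v: "solves (sys_matrix \<alpha> \<beta>) forcing v"
  define w1 where "w1 = (\<lambda>t. (P_mat (- t) *v v t) $ 1)"
  define w2 where "w2 = (\<lambda>t. (P_mat (- t) *v v t) $ 2)"
  have w: "(w1 has_real_derivative u1 * w2 t) (at t within {0..})"
    "(w2 has_real_derivative u2 * w1 t + 1) (at t within {0..})" if "t \<ge> 0" for t
    using bounded_linear.has_vector_derivative[OF bounded_linear_vec_nth solves_reduced[OF u v that], of 1]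
      bounded_linear.has_vector_derivative[OF bounded_linear_vec_nth solves_reduced[OF u v that], of 2]
    by (simp_all add: w1_def w2_def R_mat_def mat2_def matrix_vector_mult_def sum_2
        has_real_derivative_iff_has_vector_derivative)
  let ?E = "\<lambda>t. (u2 * w1 t + 1)\<^sup>2 - u1 * u2 * (w2 t)\<^sup>2"
  have "(?E has_vector_derivative 0) (at t within {0..})" if "t \<in> {0..}" for t
    unfolding has_real_derivative_iff_has_vector_derivative[symmetric]
    using that by (auto intro!: derivative_eq_intros w simp: algebra_simps)
  then obtain c where E: "\<And>t. t \<ge> 0 \<Longrightarrow> ?E t = c"
    using has_vector_derivative_zero_constant[of "{0..}" ?E] by (auto simp: convex_real_interval)
  have nz: "u2 \<noteq> 0" using neg by auto
  define B where "B = (sqrt c + 1) / \<bar>u2\<bar> + sqrt (c / - (u1 * u2))"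
  have "norm (v t) \<le> B" if "t \<ge> 0" for t
  proof -
    have "- (u1 * u2) * (w2 t)\<^sup>2 \<ge> 0" using neg by (simp add: mult_nonpos_nonneg)
    then have "(u2 * w1 t + 1)\<^sup>2 \<le> c" "(w2 t)\<^sup>2 * - (u1 * u2) \<le> c"
      using E[OF that] zero_le_power2[of "u2 * w1 t + 1"] by (argo, argo)
    then have "(u2 * w1 t + 1)\<^sup>2 \<le> c" "(w2 t)\<^sup>2 \<le> c / - (u1 * u2)"
      using neg by (simp_all only: pos_le_divide_eq neg_0_less_iff_less)
    then have "\<bar>u2 * w1 t + 1\<bar> \<le> sqrt c" "\<bar>w2 t\<bar> \<le> sqrt (c / - (u1 * u2))"
      by (auto intro!: real_le_rsqrt)
    moreover from this(1) have "\<bar>u2\<bar> * \<bar>w1 t\<bar> \<le> sqrt c + 1"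
      by (simp add: abs_mult[symmetric])
    then have "\<bar>w1 t\<bar> \<le> (sqrt c + 1) / \<bar>u2\<bar>"
      using nz by (simp add: pos_le_divide_eq mult.commute)
    moreover have "norm (v t) \<le> \<bar>w1 t\<bar> + \<bar>w2 t\<bar>"
      using norm_P_mat[of "- t" "v t"] sqrt_sum_squares_le_sum_abs[of "w1 t" "w2 t"]
      by (simp add: norm_vec2 w1_def w2_def)
    ultimately show ?thesis by (simp add: B_def)
  qed
  then show "bounded (v ` {0..})"
    by (auto simp: bounded_iff)
qed


text \<open>In the fixed frame the motion combines the rotation of period \<open>2 \<pi>\<close> with an oscillation of
  frequency \<open>\<omega>\<close>, so it is periodic only if the two are commensurable. The motion vanishes exactly
  when \<open>\<omega> t\<close> is a multiple of \<open>2 \<pi>\<close>; hence a period \<open>T\<close> is one of the oscillation, and then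
  \<open>P_mat T\<close> has to fix the values of the motion, which forces \<open>T\<close> to be a multiple of \<open>2 \<pi>\<close> as
  well.\<close>

lemma periodic_iff_rational_frequency:
  assumes \<omega>: "\<omega> > 0" and a: "a \<noteq> 0" and b: "b \<noteq> 0"
    and w: "\<And>t. t \<ge> 0 \<Longrightarrow> P_mat (- t) *v v t = vector [a * (1 - cos (\<omega> * t)), b * sin (\<omega> * t)]"
  shows "(\<exists>T. periodic_with T v) \<longleftrightarrow> \<omega> \<in> \<rat>"
proof
  assume "\<exists>T. periodic_with T v"
  then obtain T where T: "T > 0" and per: "\<And>t. t \<ge> 0 \<Longrightarrow> v (t + T) = v t"
    by (auto simp: periodic_with_def)
  have "v 0 = 0"
    using w[of 0] by (simp add: vec_eq_iff forall_2)
  then have "v T = 0"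
    using per[of 0] by simp
  then have "vector [a * (1 - cos (\<omega> * T)), b * sin (\<omega> * T)] = (0 :: real^2)"
    using w[of T] T by (metis less_imp_le matrix_vector_mult_0_right)
  then have "cos (\<omega> * T) = 1"
    using a by (simp add: vec_eq_iff forall_2)
  then obtain m :: int where m: "\<omega> * T = of_int m * 2 * pi"
    using cos_one_2pi_int by auto
  (* a time at which the oscillation, and hence the motion, is nonzero *)
  define t where "t = pi / (2 * \<omega>)"
  have t: "t \<ge> 0" "\<omega> * t = pi / 2" using \<omega> by (simp_all add: t_def)
  have "cos (\<omega> * (t + T)) = cos (\<omega> * t)" "sin (\<omega> * (t + T)) = sin (\<omega> * t)"
    using \<open>cos (\<omega> * T) = 1\<close> cos_one_sin_zero[of "\<omega> * T"]
    by (simp_all add: distrib_left cos_add sin_add)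
  then have eq: "P_mat (- (t + T)) *v v t = P_mat (- t) *v v t"
    using w[of "t + T"] w[of t] per[of t] t(1) T by simp
  have "P_mat T *v v t = P_mat (t + T) *v (P_mat (- t) *v v t)"
    by (simp add: matrix_vector_mul_assoc P_mat_add)
  also have "\<dots> = v t"
    by (simp only: eq[symmetric] P_mat_minus_cancel)
  finally have "P_mat T *v v t = v t" .
  moreover have "v t \<noteq> 0"
  proof
    assume "v t = 0"
    then have "vector [a * (1 - cos (\<omega> * t)), b * sin (\<omega> * t)] = (0 :: real^2)"
      using w[OF t(1)] by simp
    then show False
      using b by (simp add: t(2) vec_eq_iff forall_2)
  qed
  ultimately have "cos T = 1"
    by (rule P_mat_fixed_vector)
  then obtain n :: int where n: "T = of_int n * 2 * pi"
    using cos_one_2pi_int by auto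
  have "n \<noteq> 0" using n T by auto
  then have "\<omega> = of_int m / of_int n"
    using m n by (simp add: field_simps)
  then show "\<omega> \<in> \<rat>" by simp
next
  assume "\<omega> \<in> \<rat>"
  then obtain p q :: int where q: "q > 0" and \<omega>_eq: "\<omega> = of_int p / of_int q"
    by (rule Rats_cases') blast
  define T where "T = 2 * pi * of_int q"
  have \<omega>T: "\<omega> * T = 2 * pi * of_int p" using q by (simp add: T_def \<omega>_eq)
  have "v (t + T) = v t" if t: "t \<ge> 0" for t
  proof -
    have "T \<ge> 0" using q by (simp add: T_def)
    then have "P_mat (- (t + T)) *v v (t + T) = P_mat (- t) *v v t"
      using w[of "t + T"] w[of t] t \<omega>T by (simp add: distrib_left cos_add sin_add)
    moreover have "P_mat (t + T) = P_mat t"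
      by (simp add: P_mat_def T_def cos_add sin_add)
    ultimately show ?thesis by (metis P_mat_minus_cancel(1))
  qed
  then show "\<exists>T. periodic_with T v"
    using q by (auto simp: periodic_with_def T_def intro!: exI[of _ T])
qed

text \<open>Here \<open>w = (u1 t\<^sup>2 / 2, t)\<close>: growth is linear if \<open>u1 = 0\<close>. Otherwise the nilpotent \<open>R\<close> integrates
  the linear term once more, which makes the growth quadratic.\<close>

lemma motion_if_zero:
  assumes u: "u1 = 2 * \<alpha> + \<beta> - 1" "u2 = 1 - \<beta>" and zero: "u1 * u2 = 0"
    and v: "solves (sys_matrix \<alpha> \<beta>) forcing v" "v 0 = 0"
  shows "t \<ge> 0 \<Longrightarrow> norm (v t) = sqrt ((u1 * t\<^sup>2 / 2)\<^sup>2 + t\<^sup>2)"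
    and "t \<ge> 0 \<Longrightarrow> norm (v t) \<ge> t"
    and "marginally_unstable v"
    and "u1 \<noteq> 0 \<Longrightarrow> ((\<lambda>t. norm (v t) / t\<^sup>2) \<longlongrightarrow> \<bar>u1\<bar> / 2) at_top"
proof -
  show n: "norm (v t) = sqrt ((u1 * t\<^sup>2 / 2)\<^sup>2 + t\<^sup>2)" if "t \<ge> 0" for t
    using norm_rotated[OF reduced_solution_degenerate[OF u v zero that]] by simp
  show ge: "norm (v t) \<ge> t" if "t \<ge> 0" for t
    using n[OF that] by (simp add: real_le_rsqrt)
  have "\<not> stable_motion v"
  proof
    assume "stable_motion v"
    then obtain B where B: "\<And>t. t \<ge> 0 \<Longrightarrow> norm (v t) \<le> B"
      by (auto simp: stable_motion_def bounded_iff)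
    from B[of "\<bar>B\<bar> + 1"] ge[of "\<bar>B\<bar> + 1"] show False by linarith
  qed
  (* the coefficient of t^4 in the squared norm *)
  define a where "a = (u1 / 2)\<^sup>2"
  have ev: "\<forall>\<^sub>F t in at_top. sqrt (a * t ^ 4 + t\<^sup>2) = norm (v t)"
    using eventually_ge_at_top[of 0]
    by eventually_elim (simp add: n a_def power_mult_distrib power_divide flip: power_mult)
  have "((\<lambda>t. norm (v t) / exp (\<epsilon> * t)) \<longlongrightarrow> 0) at_top" if "\<epsilon> > 0" for \<epsilon>
  proof -
    have "((\<lambda>t. sqrt (a * t ^ 4 + t\<^sup>2) / exp (\<epsilon> * t)) \<longlongrightarrow> 0) at_top"
    proof (cases "a = 0")
      case True
      have "((\<lambda>t. sqrt (t\<^sup>2) / exp (\<epsilon> * t)) \<longlongrightarrow> 0) at_top"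
        using \<open>\<epsilon> > 0\<close> by real_asymp
      with True show ?thesis by simp
    next
      case False
      then have "a > 0" by (simp add: a_def)
      with \<open>\<epsilon> > 0\<close> show ?thesis by real_asymp
    qed
    then show ?thesis
      by (rule Lim_transform_eventually) (use ev in \<open>auto elim: eventually_mono\<close>)
  qed
  with \<open>\<not> stable_motion v\<close> show "marginally_unstable v"
    by (simp add: marginally_unstable_def)
  assume "u1 \<noteq> 0"
  then have "a > 0" by (simp add: a_def)
  then have "((\<lambda>t. sqrt (a * t ^ 4 + t\<^sup>2) / t\<^sup>2) \<longlongrightarrow> sqrt a) at_top"
    by (real_asymp simp: powr_half_sqrt)
  moreover have "sqrt a = \<bar>u1\<bar> / 2"
    by (simp add: a_def real_sqrt_abs)
  ultimately show "((\<lambda>t. norm (v t) / t\<^sup>2) \<longlongrightarrow> \<bar>u1\<bar> / 2) at_top"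
    by (simp only:) (erule Lim_transform_eventually, use ev in \<open>auto elim: eventually_mono\<close>)
qed

lemma exponentially_unstable_not_stable:
  assumes "exponentially_unstable w"
  shows "\<not> stable_motion w"
proof
  assume "stable_motion w"
  then obtain B where B: "\<And>t. t \<ge> 0 \<Longrightarrow> norm (w t) \<le> B"
    by (auto simp: stable_motion_def bounded_iff)
  obtain c \<mu> T where c: "c > 0" "\<mu> > 0" "\<And>t. t \<ge> T \<Longrightarrow> c * exp (\<mu> * t) \<le> norm (w t)"
    using assms by (auto simp: exponentially_unstable_def)
  define t where "t = max (max 0 T) (\<bar>B\<bar> / (c * \<mu>))"
  have "\<bar>B\<bar> / (c * \<mu>) \<le> t" by (simp add: t_def)
  then have "\<bar>B\<bar> \<le> c * (\<mu> * t)"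
    using c by (simp add: pos_divide_le_eq mult_ac)
  also have "\<dots> < c * exp (\<mu> * t)"
    using c exp_ge_add_one_self[of "\<mu> * t"] by (intro mult_strict_left_mono) linarith+
  also have "\<dots> \<le> B"
    using c(3)[of t] B[of t] unfolding t_def by linarith
  finally show False by simp
qed

lemma exponentially_unstable_if_pos:
  assumes u: "u1 = 2 * \<alpha> + \<beta> - 1" "u2 = 1 - \<beta>" and pos: "u1 * u2 > 0"
    and v: "solves (sys_matrix \<alpha> \<beta>) forcing v" "v 0 = 0"
  shows "exponentially_unstable v"
proof -
  define \<omega> where "\<omega> = sqrt (u1 * u2)"
  have \<omega>: "\<omega> > 0" "u1 * u2 = \<omega>\<^sup>2" using pos by (simp_all add: \<omega>_def)
  (* for \<omega> t \<ge> 1 the decaying half of sinh costs at most half of the growing one *)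
  have "1 / (4 * \<omega>) * exp (\<omega> * t) \<le> norm (v t)" if t: "t \<ge> 1 / \<omega>" for t
  proof -
    have t0: "t \<ge> 0" using t \<omega> by (meson divide_nonneg_pos order_trans zero_le_one)
    have "\<omega> * t \<ge> 1" using t \<omega> by (simp add: pos_divide_le_eq mult.commute)
    then have "2 \<le> exp (\<omega> * t)"
      using exp_ge_add_one_self[of "\<omega> * t"] by linarith
    moreover have "exp (- (\<omega> * t)) \<le> 1" using \<open>\<omega> * t \<ge> 1\<close> by simp
    ultimately have "exp (\<omega> * t) / 4 \<le> sinh (\<omega> * t)"
      unfolding sinh_field_def by argo
    then have "1 / (4 * \<omega>) * exp (\<omega> * t) \<le> sinh (\<omega> * t) / \<omega>"
      using \<omega> by (simp add: field_simps)
    also have "\<dots> \<le> norm (v t)"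
      using norm_rotated[OF reduced_solution_hyperbolic[OF u v _ \<omega>(2) t0]] \<omega>(1)
      by (simp add: real_le_rsqrt)
    finally show ?thesis .
  qed
  then show ?thesis
    unfolding exponentially_unstable_def using \<omega>(1)
    by (intro exI[of _ "1 / (4 * \<omega>)"] exI[of _ \<omega>] exI[of _ "1 / \<omega>"] conjI) auto
qed

section \<open>Dependence on the inertia parameters\<close>

theorem mainTheorem1:
  fixes Ixx Iyy Izz IB Ixx' Izz' \<alpha> \<beta> u1 u2 \<sigma> :: real
    and x z :: "real \<Rightarrow> real" and v :: "real \<Rightarrow> real^2" and R :: "real^2^2"
  assumes pos: "Ixx > 0" "Iyy > 0" "Izz > 0" "IB > 0"
    and Ixx': "Ixx' = Ixx + IB"
    and Izz': "Izz' = Izz + IB"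
    and alpha: "\<alpha> = (Ixx - Izz) * (Ixx - Iyy + 2 * IB + Izz) / (2 * (IB + Izz) * (Ixx + IB))"
    and beta: "\<beta> = - ((Ixx - Iyy - Izz) / (IB + Izz))"
    and u1: "u1 = 2 * \<alpha> + \<beta> - 1"
    and u2: "u2 = 1 - \<beta>"
    and sigma: "\<sigma> = - ((Iyy - Ixx') * (Iyy - Izz'))"
    and R: "R = R_mat u1 u2"
    and v: "v = (\<lambda>\<tau>. vector [x \<tau>, z \<tau>])"
    and sol: "solves (sys_matrix \<alpha> \<beta>) forcing v"
    and init: "x 0 = 0" "z 0 = 0"
  shows
    "(\<forall>\<Phi>. is_transition_matrix (sys_matrix \<alpha> \<beta>) \<Phi> \<longleftrightarrow>
         \<Phi> = (\<lambda>\<tau> \<tau>0. P_mat \<tau> ** mat_exp ((\<tau> - \<tau>0) *\<^sub>R R) ** matrix_inv (P_mat \<tau>0)))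
   \<and> complex_eigenvalues R =
       {csqrt (complex_of_real (u1 * u2)), - csqrt (complex_of_real (u1 * u2))}
   \<and> u1 * u2 = - ((Iyy - Ixx') * (Iyy - Izz') / (Ixx' * Izz'))
   \<and> sgn (u1 * u2) = sgn \<sigma>
   \<and> (\<sigma> < 0 \<longrightarrow>
        (\<forall>\<mu>\<in>complex_eigenvalues R. Re \<mu> = 0 \<and> \<mu> \<noteq> 0)
      \<and> stable_system (sys_matrix \<alpha> \<beta>) forcing
      \<and> stable_motion v
      \<and> periodic_with (2 * pi / sqrt (- (u1 * u2))) (\<lambda>\<tau>. matrix_inv (P_mat \<tau>) *v v \<tau>)
      \<and> ((\<exists>T. periodic_with T v) \<longleftrightarrow> sqrt (- (u1 * u2)) \<in> \<rat>))
   \<and> (\<sigma> = 0 \<longrightarrow>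
        complex_eigenvalues R = {0}
      \<and> (\<forall>\<tau>. mat_exp (\<tau> *\<^sub>R R) = mat 1 + \<tau> *\<^sub>R R)
      \<and> marginally_unstable v
      \<and> (\<forall>\<tau>\<ge>0. norm (v \<tau>) \<ge> \<tau>)
      \<and> (Iyy = Izz' \<longrightarrow> (\<forall>\<tau>\<ge>0. norm (v \<tau>) = \<tau>))
      \<and> (Iyy \<noteq> Izz' \<longrightarrow> ((\<lambda>\<tau>. norm (v \<tau>) / \<tau>\<^sup>2) \<longlongrightarrow> \<bar>u1\<bar> / 2) at_top))
   \<and> (\<sigma> > 0 \<longrightarrow>
        (\<forall>\<mu>\<in>complex_eigenvalues R. \<mu> \<in> \<real>)
      \<and> exponentially_unstable v)
   \<and> ((Ixx' > Iyy \<and> Izz' > Iyy) \<or> (Ixx' < Iyy \<and> Izz' < Iyy) \<longrightarrow>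
        stable_system (sys_matrix \<alpha> \<beta>) forcing \<and> stable_motion v)
   \<and> (\<not> ((Ixx' > Iyy \<and> Izz' > Iyy) \<or> (Ixx' < Iyy \<and> Izz' < Iyy)) \<longrightarrow>
        \<not> stable_system (sys_matrix \<alpha> \<beta>) forcing \<and> \<not> stable_motion v)"
proof -
  let ?A = "sys_matrix \<alpha> \<beta>"
  have pos': "Ixx' > 0" "Izz' > 0"
    using pos by (simp_all add: Ixx' Izz')
  have u1': "u1 = (Iyy - Izz') / Ixx'"
  proof -
    have e: "Ixx - Izz = Ixx' - Izz'" "Ixx - Iyy + 2 * IB + Izz = Ixx' + Izz' - Iyy"
      "IB + Izz = Izz'" "Ixx + IB = Ixx'" "Ixx - Iyy - Izz = Ixx' - Iyy - Izz'"
      by (simp_all add: Ixx' Izz')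
    have "2 * \<alpha> = (Ixx' - Izz') * (Ixx' + Izz' - Iyy) / (Izz' * Ixx')"
      unfolding alpha e by simp
    moreover have "\<beta> = (Iyy + Izz' - Ixx') / Izz'"
      unfolding beta e minus_divide_left by simp
    ultimately have "u1 = (Ixx' - Izz') * (Ixx' + Izz' - Iyy) / (Izz' * Ixx') + (Iyy + Izz' - Ixx') / Izz' - 1"
      by (simp add: u1)
    also have "\<dots> = (Iyy - Izz') / Ixx'"
      using pos' by (simp add: divide_simps) algebra
    finally show ?thesis .
  qed
  have u2': "u2 = (Ixx' - Iyy) / Izz'"
    using pos' by (simp add: u2 beta Ixx' Izz' field_simps)
  have prod: "u1 * u2 = - ((Iyy - Ixx') * (Iyy - Izz') / (Ixx' * Izz'))"
  proof -
    have "(Iyy - Izz') * (Ixx' - Iyy) = - ((Iyy - Ixx') * (Iyy - Izz'))"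
      by algebra
    then show ?thesis
      by (simp only: u1' u2' times_divide_times_eq minus_divide_left)
  qed
  then have prod_\<sigma>: "u1 * u2 = \<sigma> / (Ixx' * Izz')"
    by (simp add: sigma)
  have sgn: "sgn (u1 * u2) = sgn \<sigma>"
    using pos' by (simp add: prod_\<sigma> sgn_divide sgn_mult)
  have sgn_iff: "u1 * u2 < 0 \<longleftrightarrow> \<sigma> < 0" "u1 * u2 = 0 \<longleftrightarrow> \<sigma> = 0" "u1 * u2 > 0 \<longleftrightarrow> \<sigma> > 0"
    using sgn by (metis sgn_less, metis sgn_0_0, metis sgn_greater)
  note eig = complex_eigenvalues_R_mat[of u1 u2, folded R]
  have v0: "v 0 = 0"
    by (simp add: v init vec_eq_iff forall_2)

  have neg: "(\<forall>\<mu>\<in>complex_eigenvalues R. Re \<mu> = 0 \<and> \<mu> \<noteq> 0) \<and> stable_system ?A forcing \<and> stable_motion v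
      \<and> periodic_with (2 * pi / sqrt (- (u1 * u2))) (\<lambda>\<tau>. matrix_inv (P_mat \<tau>) *v v \<tau>)
      \<and> ((\<exists>T. periodic_with T v) \<longleftrightarrow> sqrt (- (u1 * u2)) \<in> \<rat>)" if "\<sigma> < 0"
  proof (intro conjI)
    have lt: "u1 * u2 < 0" using that sgn_iff by simp
    define \<omega> where "\<omega> = sqrt (- (u1 * u2))"
    have \<omega>: "\<omega> > 0" "u1 * u2 = - \<omega>\<^sup>2" using lt by (simp_all add: \<omega>_def)
    have w: "P_mat (- t) *v v t = vector [u1 / \<omega>\<^sup>2 * (1 - cos (\<omega> * t)), 1 / \<omega> * sin (\<omega> * t)]"
      if "t \<ge> 0" for t
      using reduced_solution_oscillating[OF u1 u2 sol v0 _ \<omega>(2) that] \<omega>(1) by simp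
    have "csqrt (complex_of_real (u1 * u2)) = \<i> * complex_of_real \<omega>"
      using lt by (simp add: csqrt_of_real' \<omega>_def del: of_real_mult)
    then show "\<forall>\<mu>\<in>complex_eigenvalues R. Re \<mu> = 0 \<and> \<mu> \<noteq> 0"
      using \<omega>(1) by (simp only: eig) auto
    show st: "stable_system ?A forcing"
      by (rule stable_system_if_neg[OF u1 u2 lt])
    show "stable_motion v"
      using st sol by (simp add: stable_system_def)
    show "periodic_with (2 * pi / sqrt (- (u1 * u2))) (\<lambda>\<tau>. matrix_inv (P_mat \<tau>) *v v \<tau>)"
      unfolding periodic_with_def \<omega>_def[symmetric] P_mat_inverse
    proof (intro conjI allI impI)
      show T: "2 * pi / \<omega> > 0" using \<omega>(1) by simp
      fix t :: real assume t: "t \<ge> 0"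
      have "\<omega> * (t + 2 * pi / \<omega>) = \<omega> * t + 2 * pi" using \<omega>(1) by (simp add: field_simps)
      then show "P_mat (- (t + 2 * pi / \<omega>)) *v v (t + 2 * pi / \<omega>) = P_mat (- t) *v v t"
        using w[of t] w[of "t + 2 * pi / \<omega>"] t T by simp
    qed
    show "(\<exists>T. periodic_with T v) \<longleftrightarrow> sqrt (- (u1 * u2)) \<in> \<rat>"
      unfolding \<omega>_def[symmetric]
      by (rule periodic_iff_rational_frequency[OF \<omega>(1) _ _ w]) (use \<omega> lt in auto)
  qed

  have zero: "complex_eigenvalues R = {0} \<and> (\<forall>\<tau>. mat_exp (\<tau> *\<^sub>R R) = mat 1 + \<tau> *\<^sub>R R)
      \<and> marginally_unstable v \<and> (\<forall>\<tau>\<ge>0. norm (v \<tau>) \<ge> \<tau>)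
      \<and> (Iyy = Izz' \<longrightarrow> (\<forall>\<tau>\<ge>0. norm (v \<tau>) = \<tau>))
      \<and> (Iyy \<noteq> Izz' \<longrightarrow> ((\<lambda>\<tau>. norm (v \<tau>) / \<tau>\<^sup>2) \<longlongrightarrow> \<bar>u1\<bar> / 2) at_top)" if "\<sigma> = 0"
  proof (intro conjI allI impI)
    have eq: "u1 * u2 = 0" using that sgn_iff by simp
    note z = motion_if_zero[OF u1 u2 eq sol v0]
    show "complex_eigenvalues R = {0}"
      by (simp only: eig eq) simp
    show "mat_exp (t *\<^sub>R R) = mat 1 + t *\<^sub>R R" for t
      by (rule mat_exp_nilpotent) (simp only: R R_mat_square eq scaleR_zero_left)
    show "marginally_unstable v" "t \<ge> 0 \<Longrightarrow> norm (v t) \<ge> t" for t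
      by (rule z; assumption)+
    show "norm (v t) = t" if "Iyy = Izz'" "t \<ge> 0" for t
      using z(1)[of t] that by (simp add: u1')
    show "((\<lambda>\<tau>. norm (v \<tau>) / \<tau>\<^sup>2) \<longlongrightarrow> \<bar>u1\<bar> / 2) at_top" if "Iyy \<noteq> Izz'"
      by (rule z) (use that pos' in \<open>simp add: u1'\<close>)
  qed

  have pos_case: "(\<forall>\<mu>\<in>complex_eigenvalues R. \<mu> \<in> \<real>) \<and> exponentially_unstable v" if "\<sigma> > 0"
  proof
    have gt: "u1 * u2 > 0" using that sgn_iff by simp
    then have "csqrt (complex_of_real (u1 * u2)) = complex_of_real (sqrt (u1 * u2))"
      by (simp add: csqrt_of_real' del: of_real_mult)
    then show "\<forall>\<mu>\<in>complex_eigenvalues R. \<mu> \<in> \<real>"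
      by (simp only: eig) auto
    show "exponentially_unstable v"
      by (rule exponentially_unstable_if_pos[OF u1 u2 gt sol v0])
  qed

  have region: "(Ixx' > Iyy \<and> Izz' > Iyy) \<or> (Ixx' < Iyy \<and> Izz' < Iyy) \<longleftrightarrow> \<sigma> < 0"
    by (auto simp: sigma zero_less_mult_iff)
  have unstable: "\<not> stable_motion v" if "\<not> \<sigma> < 0"
  proof (cases "\<sigma> = 0")
    case True
    with zero show ?thesis by (simp add: marginally_unstable_def)
  next
    case False
    with that pos_case show ?thesis
      by (intro exponentially_unstable_not_stable) auto
  qed
  have transition: "is_transition_matrix ?A \<Phi> \<longleftrightarrow>
      \<Phi> = (\<lambda>\<tau> \<tau>0. P_mat \<tau> ** mat_exp ((\<tau> - \<tau>0) *\<^sub>R R) ** matrix_inv (P_mat \<tau>0))" for \<Phi>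
    unfolding R by (rule transition_matrix_iff[OF u1 u2])
  have stable: "stable_system ?A forcing \<and> stable_motion v" if "\<sigma> < 0"
    using neg[OF that] by blast
  have unstable': "\<not> stable_system ?A forcing \<and> \<not> stable_motion v" if "\<not> \<sigma> < 0"
    using unstable[OF that] sol by (auto simp: stable_system_def)
  show ?thesis
    unfolding region
    by (assumption | rule transition eig prod sgn neg zero pos_case stable unstable'
        | rule conjI impI allI)+
qed

end
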